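(* There are absolute constants $c>0$ and $C\geq0$ such that for every finite set $A\subset\mathbb{R}$ with $|A|>1$ and $0\notin A$, $$|A+A|^{10}\,|AA|^{17}\;\geq\; c\,\frac{|A|^{33}}{\log^{C}|A|}.$$
   Context: $A+A=\{a+b:a,b\in A\}$, $AA=\{ab:a,b\in A\}$. Logarithms base $2$. *)

theory Defs
  imports Complex_Main "HOL-Library.Set_Algebras"
begin

end

theory Submission
  imports Defs "HOL-Analysis.Convex"
begin

text \<open>
  Write \<open>n = |A|\<close>, \<open>m = |AA|\<close> and \<open>S = A + A\<close>. On a Cartesian grid the Szemeredi--Trotter bound is
  elementary: cut the grid into \<open>r \<times> r\<close> cells of equal size; by monotonicity a line meets at most
  \<open>2r\<close> of them, and two points in a common cell lie on at most one line.

  Choose \<open>B \<subseteq> A\<close> with \<open>|B| \<ge> n/2\<close> such that every \<open>b \<in> B\<close> has at least \<open>n/2\<close> partners \<open>c \<in> A\<close> for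
  which \<open>bc\<close> is popular, i.e. has \<open>\<ge> n\<^sup>2/(4m)\<close> representations in \<open>AA\<close>. Let \<open>B\<^sub>s = B \<inter> (B + s)\<close> and
  let \<open>P\<close> be a dyadic level \<open>|B\<^sub>s| \<approx> \<tau>\<close> which, up to a logarithm, carries the additive energy
  \<open>|P| \<tau>\<^sup>2 \<ge> |B|\<^sup>4 / |S|\<close>. Count the pairs \<open>(s, y)\<close> with \<open>s \<in> P\<close> and \<open>y, y - s \<in> S\<close>; let \<open>N\<close> be their number.
  Since \<open>B + B\<^sub>s \<subseteq> S \<inter> (S + s)\<close>, the Cauchy--Schwarz inequality bounds \<open>N\<close> from below by
  \<open>(|B| |P| \<tau>)\<^sup>2\<close> over the third energy of \<open>B\<close>, and writing \<open>b - x = (bc)/c - x\<close> the incidence bound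
  shows that this energy is \<open>\<lesssim> n m\<^sup>2\<close>.
  For the upper bound, writing \<open>s = (sc)/c\<close> gives \<open>(N n)\<^sup>3 \<lesssim> (n |S|\<^sup>2 |Z|)\<^sup>2\<close>, where \<open>Z\<close> consists of the
  dilates \<open>sc\<close> with \<open>\<gtrsim> \<tau>\<close> representations as a popular product minus a product. Expanding the popular
  product in its many representations, a third use of the incidence bound yields
  \<open>|Z| \<lesssim> m\<^sup>5 / (n\<^sup>2 \<tau>\<^sup>3)\<close>. Altogether \<open>n\<^sup>3\<^sup>2 \<lesssim> m\<^sup>1\<^sup>6 |S|\<^sup>1\<^sup>0\<close>, and \<open>n \<le> m\<close> finishes the proof.
\<close>

section \<open>Incidences with Cartesian grids\<close>

text \<open>Keep one representative in each fibre of \<open>k\<close>. Any other \<open>x\<close>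
  collides with the representative of its fibre, and that collision determines
  \<open>x\<close>.\<close>

lemma card_le_card_image_plus_collisions:
  assumes "finite P"
  shows "card P \<le> card (k ` P) + card {(x, x'). x \<in> P \<and> x' \<in> P \<and> x \<noteq> x' \<and> k x = k x'}"
proof -
  define h where "h = inv_into P k"
  define R where "R = h ` k ` P"
  have h: "h (k x) \<in> P" "k (h (k x)) = k x" if "x \<in> P" for x
    using that by (auto simp: h_def inv_into_into f_inv_into_f)
  have "card P \<le> card R + card (P - R)"
    using card_Un_le[of R "P - R"] h assms
    by (metis R_def Un_Diff_cancel Un_upper2 card_mono finite_Un finite_imageI order_trans)
  moreover have "card R \<le> card (k ` P)"
    unfolding R_def by (intro card_image_le finite_imageI assms)
  moreover have "card (P - R) \<le> card {(x, x'). x \<in> P \<and> x' \<in> P \<and> x \<noteq> x' \<and> k x = k x'}"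
  proof (rule card_inj_on_le[of "\<lambda>x. (x, h (k x))"])
    show "finite {(x, x'). x \<in> P \<and> x' \<in> P \<and> x \<noteq> x' \<and> k x = k x'}"
      by (rule finite_subset[of _ "P \<times> P"]) (use assms in auto)
    show "(\<lambda>x. (x, h (k x))) ` (P - R) \<subseteq> {(x, x'). x \<in> P \<and> x' \<in> P \<and> x \<noteq> x' \<and> k x = k x'}"
      using h by (force simp: R_def)
  qed (auto simp: inj_on_def)
  ultimately show ?thesis by linarith
qed

text \<open>Cauchy-Schwarz for the fibre sizes of \<open>f\<close> over \<open>W\<close>: they sum
  to |T|, and their squares sum to the number of collisions.\<close>

lemma card_square_le_collisions:
  assumes "finite T" "finite W" "f ` T \<subseteq> W"
  shows "(card T)\<^sup>2 \<le> card W * card {(t, t'). t \<in> T \<and> t' \<in> T \<and> f t = f t'}"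
proof -
  let ?F = "\<lambda>w. {t \<in> T. f t = w}"
  have "{(t, t'). t \<in> T \<and> t' \<in> T \<and> f t = f t'} = (\<Union>w\<in>W. ?F w \<times> ?F w)"
    using assms by auto
  also have "card \<dots> = (\<Sum>w\<in>W. card (?F w \<times> ?F w))"
    using assms by (intro card_UN_disjoint) auto
  finally have c: "card {(t, t'). t \<in> T \<and> t' \<in> T \<and> f t = f t'} = (\<Sum>w\<in>W. (card (?F w))\<^sup>2)"
    by (simp add: card_cartesian_product power2_eq_square)
  have "T = (\<Union>w\<in>W. ?F w)" using assms by auto
  then have "card T = card (\<Union>w\<in>W. ?F w)" by simp
  also have "\<dots> = (\<Sum>w\<in>W. card (?F w))"
    using assms by (intro card_UN_disjoint) auto
  finally have t: "card T = (\<Sum>w\<in>W. card (?F w))" .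
  have "real ((card T)\<^sup>2) \<le> real (card W * card {(t, t'). t \<in> T \<and> t' \<in> T \<and> f t = f t'})"
    unfolding c t using Cauchy_Schwarz_ineq_sum[of "\<lambda>_. 1::real" "\<lambda>w. real (card (?F w))" W]
    by simp
  then show ?thesis by linarith
qed

text \<open>Blocks consist of consecutive ranks. The labelling is monotone on the whole type, so
  that it can be composed with a line.\<close>

lemma ordered_block_partition:
  fixes X :: "'a::linorder set"
  assumes "finite X" "1 \<le> r" "r \<le> card X"
  obtains f b where "mono f" "\<And>x. x \<in> X \<Longrightarrow> f x < r"
    "\<And>i. card {x \<in> X. f x = i} \<le> b" "b * r \<le> 2 * card X"
proof -
  \<comment> \<open>This is |X| / r rounded up; \<open>r \<le> card X\<close> then bounds
    \<open>b * r\<close> by twice |X|.\<close>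
  define b where "b = (card X + r - 1) div r"
  define rk where "rk x = card {y \<in> X. y < x}" for x
  have b: "b * r \<le> 2 * card X" "card X \<le> b * r" "b > 0"
  proof -
    have "b * r \<le> card X + r - 1" unfolding b_def by (rule div_times_less_eq_dividend)
    then show "b * r \<le> 2 * card X" using assms by linarith
    have "card X + r - 1 < b * r + r"
      unfolding b_def using assms dividend_less_div_times[of r "card X + r - 1"] by simp
    then show "card X \<le> b * r" by linarith
    show "b > 0" unfolding b_def using assms by (simp add: div_greater_zero_iff)
  qed
  have mono: "mono rk" unfolding rk_def using assms
    by (intro monoI card_mono) auto
  have strict: "rk x < rk y" if "x \<in> X" "x < y" for x y
    unfolding rk_def using assms that by (intro psubset_card_mono) auto
  have inj: "inj_on rk X"
    by (rule linorder_inj_onI) (use strict in force)+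
  show ?thesis
  proof
    show "mono (\<lambda>x. rk x div b)" using mono by (auto simp: mono_def div_le_mono)
    show "rk x div b < r" if "x \<in> X" for x
    proof -
      have "rk x < card X" unfolding rk_def using assms that by (intro psubset_card_mono) auto
      then show ?thesis using b by (simp add: div_less_iff_less_mult mult.commute)
    qed
    show "card {x \<in> X. rk x div b = i} \<le> b" for i
    proof -
      have "card {x \<in> X. rk x div b = i} \<le> card {i * b..<i * b + b}"
      proof (rule card_inj_on_le)
        show "inj_on rk {x \<in> X. rk x div b = i}" using inj by (auto simp: inj_on_def)
        show "rk ` {x \<in> X. rk x div b = i} \<subseteq> {i * b..<i * b + b}"
          using b(3) dividend_less_div_times[OF b(3)] by (auto simp: add.commute)
      qed auto
      then show ?thesis by simp
    qed
    show "b * r \<le> 2 * card X" by (fact b)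
  qed
qed

text \<open>Along a nondecreasing line both cell indices can only grow, so their sum, which is below
  \<open>2 * r\<close>, determines the cell.\<close>

lemma line_meets_few_cells:
  fixes f g :: "real \<Rightarrow> nat" and u v :: real
  assumes "mono f" "mono g" "\<And>x. x \<in> P \<Longrightarrow> f x < r" "\<And>x. x \<in> P \<Longrightarrow> g (u * x + v) < r"
  shows "card ((\<lambda>x. (f x, g (u * x + v))) ` P) \<le> 2 * r"
proof (cases "u \<ge> 0")
  case True
  let ?K = "(\<lambda>x. (f x, g (u * x + v))) ` P"
  have "f x = f x' \<and> g (u * x + v) = g (u * x' + v)"
    if "f x + g (u * x + v) = f x' + g (u * x' + v)" "x \<le> x'" for x x'
  proof -
    have "f x \<le> f x'" "g (u * x + v) \<le> g (u * x' + v)"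
      using that True assms(1,2) by (auto intro!: monoD[of f] monoD[of g] mult_left_mono)
    then show ?thesis using that by linarith
  qed
  then have *: "f x = f x' \<and> g (u * x + v) = g (u * x' + v)"
    if "f x + g (u * x + v) = f x' + g (u * x' + v)" for x x'
    using that by (metis linear)
  have "inj_on (\<lambda>(i, j). i + j) ?K"
    by (rule inj_onI) (use * in \<open>clarsimp; blast\<close>)
  moreover have "(\<lambda>(i, j). i + j) ` ?K \<subseteq> {..<2 * r}" using assms(3,4) by fastforce
  ultimately have "card ?K \<le> card {..<2 * r}" by (rule card_inj_on_le) simp
  then show ?thesis by simp
next
  case False
  let ?K = "(\<lambda>x. (f x, g (u * x + v))) ` P"
  \<comment> \<open>On a decreasing line the difference of the indices plays the role of the sum.
    Adding \<open>r\<close> keeps the natural-number subtraction from truncating.\<close>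
  have "f x = f x' \<and> g (u * x + v) = g (u * x' + v)"
    if "f x + r - g (u * x + v) = f x' + r - g (u * x' + v)" "x \<le> x'" "x \<in> P" "x' \<in> P" for x x'
  proof -
    have "f x \<le> f x'" "g (u * x' + v) \<le> g (u * x + v)"
      using that False assms(1,2) by (auto intro!: monoD[of f] monoD[of g] mult_left_mono_neg)
    then show ?thesis using that assms(4)[of x] assms(4)[of x'] by linarith
  qed
  then have *: "f x = f x' \<and> g (u * x + v) = g (u * x' + v)"
    if "f x + r - g (u * x + v) = f x' + r - g (u * x' + v)" "x \<in> P" "x' \<in> P" for x x'
    using that by (metis linear)
  have "inj_on (\<lambda>(i, j). i + r - j) ?K"
    by (rule inj_onI) (use * in \<open>clarsimp; blast\<close>)
  moreover have "(\<lambda>(i, j). i + r - j) ` ?K \<subseteq> {..<2 * r}" using assms(3,4) by fastforce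
  ultimately have "card ?K \<le> card {..<2 * r}" by (rule card_inj_on_le) simp
  then show ?thesis by simp
qed

text \<open>A line is encoded by slope and intercept, so there are no vertical lines and a point on
  it is given by its abscissa alone.\<close>

definition incidences :: "real set \<Rightarrow> real set \<Rightarrow> (real \<times> real) set \<Rightarrow> ((real \<times> real) \<times> real) set"
  where "incidences X Y L = {((u, v), x). (u, v) \<in> L \<and> x \<in> X \<and> u * x + v \<in> Y}"

lemma finite_incidences: "finite X \<Longrightarrow> finite L \<Longrightarrow> finite (incidences X Y L)"
  by (rule finite_subset[of _ "L \<times> X"]) (auto simp: incidences_def)

text \<open>A line carries at most \<open>2 * r\<close> points plus its pairs of distinct points in
  a common cell. Each such pair lies on one line only, so summing over lines counts at most all
  same-cell pairs of the grid.\<close>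

lemma card_incidences_le_cells:
  assumes "finite X" "finite Y" "finite L" "1 \<le> r" "r \<le> card X" "card X \<le> card Y"
  shows "real (card (incidences X Y L)) \<le> 2 * r * card L + 4 * (real (card X) * real (card Y))\<^sup>2 / (real r)\<^sup>2"
proof -
  obtain f b where f: "mono f" "\<And>x. x \<in> X \<Longrightarrow> f x < r"
    "\<And>i. card {x \<in> X. f x = i} \<le> b" "b * r \<le> 2 * card X"
    using ordered_block_partition[OF assms(1,4,5)] by metis
  obtain g d where g: "mono g" "\<And>x. x \<in> Y \<Longrightarrow> g x < r"
    "\<And>i. card {x \<in> Y. g x = i} \<le> d" "d * r \<le> 2 * card Y"
    using ordered_block_partition[OF assms(2,4) order_trans[OF assms(5,6)]] by metis
  define P where "P l = {x \<in> X. fst l * x + snd l \<in> Y}" for l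
  define k where "k l x = (f x, g (fst l * x + snd l))" for l x
  define Q where "Q l = {(x, x'). x \<in> P l \<and> x' \<in> P l \<and> x \<noteq> x' \<and> k l x = k l x'}" for l
  have finP: "finite (P l)" for l using assms by (simp add: P_def)
  have finQ: "finite (Q l)" for l
    by (rule finite_subset[of _ "P l \<times> P l"]) (auto simp: Q_def finP)
  have "incidences X Y L = Sigma L P" by (auto simp: incidences_def P_def)
  then have "card (incidences X Y L) = (\<Sum>l\<in>L. card (P l))"
    using assms finP by simp
  also have "\<dots> \<le> (\<Sum>l\<in>L. 2 * r + card (Q l))"
  proof (rule sum_mono)
    fix l assume "l \<in> L"
    have "card (k l ` P l) \<le> 2 * r"
      unfolding k_def by (rule line_meets_few_cells) (auto simp: f g P_def)
    with card_le_card_image_plus_collisions[OF finP[of l], of "k l"]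
    show "card (P l) \<le> 2 * r + card (Q l)" unfolding Q_def by linarith
  qed
  also have "\<dots> = 2 * r * card L + card (Sigma L Q)"
    using assms finQ by (simp add: sum.distrib)
  finally have 1: "card (incidences X Y L) \<le> 2 * r * card L + card (Sigma L Q)" .
  \<comment> \<open>Ordered pairs of grid points in a common cell, with abscissae and ordinates
    grouped separately.\<close>
  define G where "G = (SIGMA x:X. {x' \<in> X. f x' = f x}) \<times> (SIGMA y:Y. {y' \<in> Y. g y' = g y})"
  have "card (Sigma L Q) \<le> card G"
  proof (rule card_inj_on_le[of "\<lambda>((u, v), (x, x')). ((x, x'), (u * x + v, u * x' + v))"])
    show "finite G" unfolding G_def using assms by auto
    show "(\<lambda>((u, v), (x, x')). ((x, x'), (u * x + v, u * x' + v))) ` Sigma L Q \<subseteq> G"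
      by (auto simp: G_def Q_def P_def k_def)
    have *: "u = u' \<and> v = v'"
      if "x \<noteq> x'" "u * x + v = u' * x + v'" "u * x' + v = u' * x' + v'" for u v u' v' x x' :: real
    proof -
      have "(u - u') * (x - x') = 0" using that by (simp add: algebra_simps)
      then show ?thesis using that by simp
    qed
    show "inj_on (\<lambda>((u, v), (x, x')). ((x, x'), (u * x + v, u * x' + v))) (Sigma L Q)"
    proof (rule inj_onI)
      fix p q assume pq: "p \<in> Sigma L Q" "q \<in> Sigma L Q"
        and eq: "(\<lambda>((u, v), (x, x')). ((x, x'), (u * x + v, u * x' + v))) p =
          (\<lambda>((u, v), (x, x')). ((x, x'), (u * x + v, u * x' + v))) q"
      obtain u v x x' u' v' y y' where e: "p = ((u, v), (x, x'))" "q = ((u', v'), (y, y'))"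
        by (metis surj_pair)
      have "x \<noteq> x'" using pq by (simp add: e Q_def)
      moreover have "x = y" "x' = y'" "u * x + v = u' * x + v'" "u * x' + v = u' * x' + v'"
        using eq by (auto simp: e)
      ultimately show "p = q" using *[of x x' u v u' v'] by (simp add: e)
    qed
  qed
  also have "card G = (\<Sum>x\<in>X. card {x' \<in> X. f x' = f x}) * (\<Sum>y\<in>Y. card {y' \<in> Y. g y' = g y})"
    unfolding G_def using assms by (simp add: card_cartesian_product)
  also have "\<dots> \<le> (card X * b) * (card Y * d)"
    by (intro mult_mono) (use sum_bounded_above[of X _ b] sum_bounded_above[of Y _ d] f g in auto)
  finally have 2: "card (Sigma L Q) \<le> (card X * b) * (card Y * d)" .
  have "real b \<le> 2 * card X / r" "real d \<le> 2 * card Y / r"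
    using of_nat_mono[OF f(4), where 'a = real] of_nat_mono[OF g(4), where 'a = real] assms(4)
    by (simp_all add: field_simps)
  then have "real ((card X * b) * (card Y * d)) \<le> (card X * (2 * card X / r)) * (card Y * (2 * card Y / r))"
    unfolding of_nat_mult by (intro mult_mono) auto
  also have "\<dots> = 4 * (real (card X) * real (card Y))\<^sup>2 / (real r)\<^sup>2"
    by (simp add: power2_eq_square)
  finally have 3: "real ((card X * b) * (card Y * d)) \<le> 4 * (real (card X) * real (card Y))\<^sup>2 / (real r)\<^sup>2" .
  have "real (card (incidences X Y L)) \<le> real (2 * r * card L + (card X * b) * (card Y * d))"
    using 1 2 by linarith
  then show ?thesis using 3 unfolding of_nat_add by linarith
qed

text \<open>The Szemeredi-Trotter main term, cubed to stay within the naturals. The constant is 18^3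
  with 18 = 2 + 16, where 16 includes the loss from rounding the number of blocks down to an
  integer.\<close>

theorem grid_incidence_bound:
  assumes "finite X" "finite Y" "finite L" "card X \<le> card Y" "card L \<le> (card X * card Y)\<^sup>2"
  shows "card (incidences X Y L) ^ 3 \<le> 5832 * (card X * card Y * card L)\<^sup>2"
proof (cases "card L = 0")
  case True
  then have "L = {}" using assms by simp
  then have "incidences X Y L = {}" by (auto simp: incidences_def)
  then show ?thesis by simp
next
  case False
  define Q where "Q = real (card X * card Y)"
  define l where "l = real (card L)"
  \<comment> \<open>The value of \<open>r\<close> that balances \<open>r * l\<close> against Q^2 /
    r^2; the bound on \<open>card L\<close> makes it at least 1.\<close>
  define \<rho> where "\<rho> = root 3 (Q\<^sup>2 / l)"
  have l: "l > 0" using False by (simp add: l_def)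
  have "l \<le> Q\<^sup>2" unfolding l_def Q_def using assms(5) by (metis of_nat_le_iff of_nat_power)
  then have \<rho>1: "\<rho> \<ge> 1" unfolding \<rho>_def using l by simp
  have \<rho>3: "\<rho> ^ 3 * l = Q\<^sup>2" unfolding \<rho>_def using l by simp
  have cube: "(a * (\<rho> * l)) ^ 3 = a ^ 3 * (Q * l)\<^sup>2" for a
    by (simp add: power_mult_distrib flip: \<rho>3) (simp add: power2_eq_square power3_eq_cube)
  have "real (card (incidences X Y L)) \<le> 18 * (\<rho> * l)"
  proof (cases "\<rho> \<ge> card X")
    \<comment> \<open>Too few columns for that many blocks; here the trivial bound of |X| points per
      line is already good enough.\<close>
    case True
    have "card (incidences X Y L) \<le> card (L \<times> X)"
      by (rule card_mono) (use assms in \<open>auto simp: incidences_def\<close>)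
    then have "real (card (incidences X Y L)) \<le> l * card X"
      unfolding l_def card_cartesian_product by (metis of_nat_le_iff of_nat_mult)
    also have "\<dots> \<le> \<rho> * l" using True l by simp
    finally show ?thesis using \<rho>1 l by (smt (verit) mult_pos_pos)
  next
    case F: False
    define r where "r = nat \<lfloor>\<rho>\<rfloor>"
    have "1 \<le> \<lfloor>\<rho>\<rfloor>" using \<rho>1 by simp
    then have r: "real r \<le> \<rho>" "\<rho> \<le> 2 * real r" "1 \<le> r" unfolding r_def by linarith+
    then have "r \<le> card X" using F by linarith
    then have "real (card (incidences X Y L)) \<le> 2 * r * l + 4 * Q\<^sup>2 / (real r)\<^sup>2"
      using card_incidences_le_cells[OF assms(1-3) r(3) _ assms(4)] by (simp add: Q_def l_def)
    also have "2 * r * l \<le> 2 * (\<rho> * l)" using r l by simp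
    also have "4 * Q\<^sup>2 / (real r)\<^sup>2 \<le> 4 * Q\<^sup>2 / (\<rho> / 2)\<^sup>2"
      using r \<rho>1 by (intro divide_left_mono power_mono) auto
    also have "\<dots> = 16 * (\<rho> * l)"
      unfolding \<rho>3[symmetric] using \<rho>1 by (simp add: field_simps power2_eq_square power3_eq_cube)
    finally show ?thesis by simp
  qed
  then have "real (card (incidences X Y L)) ^ 3 \<le> (18 * (\<rho> * l)) ^ 3"
    by (intro power_mono) auto
  also have "\<dots> = 5832 * (Q * l)\<^sup>2" unfolding cube by simp
  finally have "real (card (incidences X Y L) ^ 3) \<le> real (5832 * (card X * card Y * card L)\<^sup>2)"
    by (simp add: Q_def l_def)
  then show ?thesis by linarith
qed

section \<open>Energies and popular differences\<close>

definition shift_part :: "real set \<Rightarrow> real \<Rightarrow> real set"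
  where "shift_part B s = {b \<in> B. b - s \<in> B}"

definition differences :: "real set \<Rightarrow> real set"
  where "differences B = (\<lambda>(a, b). a - b) ` (B \<times> B)"

lemma finite_shift_part [simp]: "finite B \<Longrightarrow> finite (shift_part B s)"
  by (simp add: shift_part_def)

lemma finite_differences [simp]: "finite B \<Longrightarrow> finite (differences B)"
  by (simp add: differences_def)

lemma differencesI: "a \<in> B \<Longrightarrow> b \<in> B \<Longrightarrow> a - b \<in> differences B"
  by (force simp: differences_def)

lemma card_differences_le: "finite B \<Longrightarrow> card (differences B) \<le> (card B)\<^sup>2"
  unfolding differences_def power2_eq_square
  by (metis card_cartesian_product card_image_le finite_cartesian_product)

lemma card_shift_part_bounds:
  assumes "finite B" "s \<in> differences B"
  shows "1 \<le> card (shift_part B s)" "card (shift_part B s) \<le> card B"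
proof -
  have "shift_part B s \<noteq> {}" using assms(2) by (force simp: shift_part_def differences_def)
  then show "1 \<le> card (shift_part B s)" using assms(1) by (simp add: Suc_le_eq card_gt_0_iff)
  show "card (shift_part B s) \<le> card B"
    using assms(1) by (intro card_mono) (auto simp: shift_part_def)
qed

text \<open>Cauchy-Schwarz bounds the number of solutions of a + b = a' + b' from below. Written as
  a - a' = b' - b = s, they are counted by pairs in \<open>shift_part B s\<close>.\<close>

lemma card_pow4_le_energy:
  assumes "finite B"
  shows "card B ^ 4 \<le> card (B + B) * (\<Sum>s\<in>differences B. (card (shift_part B s))\<^sup>2)"
proof -
  define f where "f = (\<lambda>(a, b). a + b :: real)"
  define Q where "Q = {(t, t'). t \<in> B \<times> B \<and> t' \<in> B \<times> B \<and> f t = f t'}"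
  have "(card (B \<times> B))\<^sup>2 \<le> card (B + B) * card Q"
    unfolding Q_def using assms
    by (intro card_square_le_collisions) (auto simp: f_def intro: finite_set_plus)
  moreover have "card Q \<le> card (SIGMA s:differences B. shift_part B s \<times> shift_part B s)"
  proof (rule card_inj_on_le[of "\<lambda>((a, b), (a', b')). (a - a', (a, b'))"])
    show "inj_on (\<lambda>((a, b), (a', b')). (a - a', (a, b'))) Q"
      by (auto simp: inj_on_def Q_def f_def)
    show "(\<lambda>((a, b), (a', b')). (a - a', (a, b'))) ` Q
      \<subseteq> (SIGMA s:differences B. shift_part B s \<times> shift_part B s)"
    proof clarsimp
      fix a b a' b' assume "((a, b), (a', b')) \<in> Q"
      then have *: "a \<in> B" "b \<in> B" "a' \<in> B" "b' \<in> B" "b' - (a - a') = b"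
        by (auto simp: Q_def f_def)
      then show "a - a' \<in> differences B \<and> a \<in> shift_part B (a - a') \<and> b' \<in> shift_part B (a - a')"
        by (simp add: shift_part_def differencesI)
    qed
  qed (use assms in auto)
  moreover have "card (SIGMA s:differences B. shift_part B s \<times> shift_part B s)
      = (\<Sum>s\<in>differences B. (card (shift_part B s))\<^sup>2)"
    using assms by (simp add: card_cartesian_product power2_eq_square)
  moreover have "(card (B \<times> B))\<^sup>2 = card B ^ 4"
    by (simp add: card_cartesian_product power2_eq_square power4_eq_xxxx)
  ultimately show ?thesis by (metis mult_le_mono2 order_trans)
qed

definition shift_pairs :: "real set \<Rightarrow> real set \<Rightarrow> (real \<times> real) set"
  where "shift_pairs P S = (SIGMA s:P. shift_part S s)"

text \<open>The Katz--Koester inclusion \<open>B + B\<^sub>s \<subseteq> (B + B) \<inter> (B + B + s)\<close>, where \<open>B\<^sub>s = shift_part B s\<close>.\<close>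
lemma shift_pairs_lower_bound:
  assumes "finite B" "finite P"
  shows "(card B * (\<Sum>s\<in>P. card (shift_part B s)))\<^sup>2
    \<le> card (shift_pairs P (B + B)) * (\<Sum>x\<in>differences B. card (shift_part B x) ^ 3)"
proof -
  define T where "T = B \<times> (SIGMA s:P. shift_part B s)"
  define f where "f = (\<lambda>(a :: real, s :: real, b). (s, a + b))"
  define Q where "Q = {(t, t'). t \<in> T \<and> t' \<in> T \<and> f t = f t'}"
  define R where "R = (SIGMA x:differences B. shift_part B x \<times> shift_part B x \<times> shift_part B x)"
  have finS: "finite (B + B)" using assms by (intro finite_set_plus)
  have "f ` T \<subseteq> shift_pairs P (B + B)"
  proof clarsimp
    fix a s b assume "(a, s, b) \<in> T"
    then have "a \<in> B" "s \<in> P" "b \<in> B" "b - s \<in> B" by (auto simp: T_def shift_part_def)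
    then show "f (a, s, b) \<in> shift_pairs P (B + B)"
      using set_plus_intro[of a B "b - s" B] set_plus_intro[of a B b B]
      by (auto simp: f_def shift_pairs_def shift_part_def algebra_simps)
  qed
  then have "(card T)\<^sup>2 \<le> card (shift_pairs P (B + B)) * card Q"
    unfolding Q_def using assms finS
    by (intro card_square_le_collisions) (auto simp: T_def shift_pairs_def)
  also have "card Q \<le> card R"
  \<comment> \<open>A collision has s = s' and a + b = a' + b'. With x = a - a' = b' - b, the three
    elements a, b' and b' - s all lie in \<open>shift_part B x\<close>, which produces the third
    energy.\<close>
  proof (rule card_inj_on_le[of "\<lambda>((a, s, b), (a', s', b')). (a - a', (a, b', b' - s))"])
    show "finite R" using assms by (simp add: R_def)
    show "inj_on (\<lambda>((a, s, b), (a', s', b')). (a - a', (a, b', b' - s))) Q"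
      by (auto simp: inj_on_def Q_def f_def)
    show "(\<lambda>((a, s, b), (a', s', b')). (a - a', (a, b', b' - s))) ` Q \<subseteq> R"
    proof clarsimp
      fix a s b a' s' b' assume "((a, s, b), (a', s', b')) \<in> Q"
      then have *: "a \<in> B" "b \<in> B" "a' \<in> B" "b' \<in> B" "b' - (a - a') = b" "b - s \<in> B"
        "b' - s \<in> B" "b' - s - (a - a') = b - s"
        by (auto simp: Q_def f_def T_def shift_part_def)
      have "b' - (a - a') \<in> B" "b' - s - (a - a') \<in> B" using *(2,6) unfolding *(5,8) .
      moreover have "a - (a - a') \<in> B" using * by simp
      ultimately have "a \<in> shift_part B (a - a')" "b' \<in> shift_part B (a - a')"
        "b' - s \<in> shift_part B (a - a')"
        unfolding shift_part_def using *(1,4,7) by blast+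
      then show "(a - a', a, b', b' - s) \<in> R"
        unfolding R_def using differencesI[OF *(1,3)] by blast
    qed
  qed
  also have "card R = (\<Sum>x\<in>differences B. card (shift_part B x) ^ 3)"
    using assms by (simp add: R_def card_cartesian_product power3_eq_cube mult.assoc)
  finally show ?thesis
    using assms by (simp add: T_def card_cartesian_product)
qed

section \<open>Dyadic decomposition of moments\<close>

definition dyadic_level :: "('a \<Rightarrow> nat) \<Rightarrow> 'a set \<Rightarrow> nat \<Rightarrow> 'a set"
  where "dyadic_level r D k = {s \<in> D. 2 ^ k \<le> r s \<and> r s < 2 ^ (k + 1)}"

lemma sum_dyadic_levels:
  fixes h :: "'a \<Rightarrow> nat"
  assumes "finite D" "\<And>s. s \<in> D \<Longrightarrow> 1 \<le> r s" "\<And>s. s \<in> D \<Longrightarrow> r s < 2 ^ L"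
  shows "sum h D = (\<Sum>k<L. sum h (dyadic_level r D k))"
proof -
  have "D = (\<Union>k<L. dyadic_level r D k)"
  proof (intro equalityI subsetI)
    fix s assume s: "s \<in> D"
    then obtain k where k: "2 ^ k \<le> r s" "r s < 2 ^ (k + 1)"
      using ex_power_ivl1[of 2 "r s"] assms(2) by auto
    have "(2::nat) ^ k < 2 ^ L" using k assms(3)[OF s] by linarith
    then have "k < L" by simp
    then show "s \<in> (\<Union>k<L. dyadic_level r D k)" using s k by (auto simp: dyadic_level_def)
  qed (auto simp: dyadic_level_def)
  moreover have "dyadic_level r D i \<inter> dyadic_level r D j = {}" if "i < j" for i j
  proof -
    have "(2::nat) ^ (i + 1) \<le> 2 ^ j" using that by (intro power_increasing) auto
    then show ?thesis by (fastforce simp: dyadic_level_def)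
  qed
  then have "dyadic_level r D i \<inter> dyadic_level r D j = {}" if "i \<noteq> j" for i j
    using that by (metis Int_commute linorder_neqE_nat)
  then have "sum h (\<Union>k<L. dyadic_level r D k) = (\<Sum>k<L. sum h (dyadic_level r D k))"
    using assms(1) by (intro sum.UNION_disjoint) (auto simp: dyadic_level_def)
  ultimately show ?thesis by simp
qed

text \<open>Some level among the \<open>L\<close> carries at least the average share of the second
  moment; the 4 is the square of the ratio 2 within a level.\<close>

lemma dyadic_pigeonhole:
  assumes "finite D" "\<And>s. s \<in> D \<Longrightarrow> 1 \<le> r s" "\<And>s. s \<in> D \<Longrightarrow> r s < 2 ^ L" "L > 0"
  obtains k where "(\<Sum>s\<in>D. (r s)\<^sup>2) \<le> 4 * L * (card (dyadic_level r D k) * (2 ^ k)\<^sup>2)"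
proof -
  let ?h = "\<lambda>k. (\<Sum>s\<in>dyadic_level r D k. (r s)\<^sup>2)"
  have "\<exists>k<L. (\<Sum>s\<in>D. (r s)\<^sup>2) \<le> L * ?h k"
  proof (rule ccontr)
    assume "\<not> ?thesis"
    then have "(\<Sum>k<L. L * ?h k) < (\<Sum>k<L. (\<Sum>s\<in>D. (r s)\<^sup>2))"
      using assms(4) by (intro sum_strict_mono) auto
    moreover have "(\<Sum>k<L. L * ?h k) = L * (\<Sum>s\<in>D. (r s)\<^sup>2)"
      using sum_dyadic_levels[where r = r and L = L and h = "\<lambda>s. (r s)\<^sup>2", OF assms(1-3)] by (simp flip: sum_distrib_left)
    ultimately show False by simp
  qed
  then obtain k where k: "(\<Sum>s\<in>D. (r s)\<^sup>2) \<le> L * ?h k" by blast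
  have "?h k \<le> card (dyadic_level r D k) * (2 ^ (k + 1))\<^sup>2"
    by (rule order_trans[OF sum_bounded_above[where K = "(2 ^ (k + 1))\<^sup>2"]])
      (auto simp only: dyadic_level_def of_nat_id intro!: power_mono)
  also have "\<dots> = 4 * (card (dyadic_level r D k) * (2 ^ k)\<^sup>2)" by (simp add: power_mult_distrib)
  finally have "L * ?h k \<le> 4 * L * (card (dyadic_level r D k) * (2 ^ k)\<^sup>2)" by simp
  then show ?thesis using k that order_trans by blast
qed

text \<open>A weak-type cubic bound valid on every level sums to a third-moment bound at the cost of
  the number \<open>L\<close> of levels and of 2^3.\<close>

lemma sum_cubes_dyadic_le:
  assumes "finite D" "\<And>s. s \<in> D \<Longrightarrow> 1 \<le> r s" "\<And>s. s \<in> D \<Longrightarrow> r s < 2 ^ L"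
    and "\<And>k. card (dyadic_level r D k) * (2 ^ k) ^ 3 \<le> M"
  shows "(\<Sum>s\<in>D. r s ^ 3) \<le> 8 * L * M"
proof -
  have "(\<Sum>s\<in>dyadic_level r D k. r s ^ 3) \<le> 8 * M" for k
  proof -
    have "(\<Sum>s\<in>dyadic_level r D k. r s ^ 3) \<le> card (dyadic_level r D k) * (2 ^ (k + 1)) ^ 3"
      by (rule order_trans[OF sum_bounded_above[where K = "(2 ^ (k + 1)) ^ 3"]])
        (auto simp only: dyadic_level_def of_nat_id intro!: power_mono)
    also have "\<dots> = 8 * (card (dyadic_level r D k) * (2 ^ k) ^ 3)" by (simp add: power_mult_distrib)
    finally show ?thesis using assms(4)[of k] by linarith
  qed
  then have "(\<Sum>k<L. \<Sum>s\<in>dyadic_level r D k. r s ^ 3) \<le> L * (8 * M)"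
    using sum_bounded_above[of "{..<L}" _ "8 * M"] by simp
  then show ?thesis using sum_dyadic_levels[where r = r and L = L and h = "\<lambda>s. r s ^ 3", OF assms(1-3)] by simp
qed

section \<open>Sets with few products\<close>

definition product_reps :: "real set \<Rightarrow> real \<Rightarrow> (real \<times> real) set"
  where "product_reps A p = {(u, v). u \<in> A \<and> v \<in> A \<and> u * v = p}"

lemma finite_product_reps [simp]: "finite A \<Longrightarrow> finite (product_reps A p)"
  by (rule finite_subset[of _ "A \<times> A"]) (auto simp: product_reps_def)

lemma card_times_le: "finite A \<Longrightarrow> finite B \<Longrightarrow> card (A * B) \<le> card A * card (B :: real set)"
  unfolding set_times_image by (metis card_cartesian_product card_image_le finite_cartesian_product)

lemma card_le_card_times_self:
  fixes A :: "real set"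
  assumes "finite A" "0 \<notin> A"
  shows "card A \<le> card (A * A)"
proof (cases "A = {}")
  case False
  then obtain a where "a \<in> A" by blast
  then show ?thesis using assms
    by (intro card_inj_on_le[of "\<lambda>x. a * x"]) (auto simp: inj_on_def intro: finite_set_times)
qed auto

lemma card_le_card_plus_self:
  fixes A :: "real set"
  assumes "finite A"
  shows "card A \<le> card (A + A)"
proof (cases "A = {}")
  case False
  then obtain a where "a \<in> A" by blast
  then show ?thesis using assms
    by (intro card_inj_on_le[of "\<lambda>x. a + x"]) (auto simp: inj_on_def intro: finite_set_plus)
qed auto

section \<open>Popularity arguments\<close>

text \<open>At least half of \<open>U \<times> V\<close> satisfies \<open>R\<close>. Columns of
  density below 1/4 account for at most a quarter of \<open>U \<times> V\<close>, so the others must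
  make up at least a quarter of \<open>V\<close>.\<close>

lemma popular_columns:
  assumes "finite U" "finite V" "U \<noteq> {}" "\<And>u. u \<in> U \<Longrightarrow> card V \<le> 2 * card {v \<in> V. R u v}"
  shows "card V \<le> 4 * card {v \<in> V. card U \<le> 4 * card {u \<in> U. R u v}}"
proof -
  define k where "k v = card {u \<in> U. R u v}" for v
  define C where "C = {v \<in> V. card U \<le> 4 * k v}"
  have k_le: "k v \<le> card U" for v unfolding k_def using assms(1) by (intro card_mono) auto
  have "card U * card V \<le> (\<Sum>u\<in>U. 2 * card {v \<in> V. R u v})"
    using sum_bounded_below[of U "card V" "\<lambda>u. 2 * card {v \<in> V. R u v}"] assms(4) by simp
  also have "\<dots> = 2 * (\<Sum>v\<in>V. k v)"
    using sum_multicount_gen[OF assms(1,2), of R k] by (simp add: k_def flip: sum_distrib_left)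
  finally have "2 * (card U * card V) \<le> (\<Sum>v\<in>V. 4 * k v)" by (simp flip: sum_distrib_left)
  also have "\<dots> = (\<Sum>v\<in>C. 4 * k v) + (\<Sum>v\<in>V - C. 4 * k v)"
    using sum.subset_diff[of C V "\<lambda>v. 4 * k v"] assms(2) by (auto simp: C_def add.commute)
  also have "(\<Sum>v\<in>C. 4 * k v) \<le> card C * (4 * card U)"
    using sum_bounded_above[of C "\<lambda>v. 4 * k v" "4 * card U"] k_le by simp
  also have "(\<Sum>v\<in>V - C. 4 * k v) \<le> card (V - C) * card U"
    by (rule order_trans[OF sum_bounded_above[where K = "card U"]]) (auto simp: C_def)
  also have "card (V - C) * card U \<le> card V * card U"
    using assms(2) by (simp add: card_mono)
  finally have "card U * card V \<le> card U * (4 * card C)" by (simp add: algebra_simps)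
  then show ?thesis using assms(1,3) by (simp add: C_def k_def card_gt_0_iff)
qed

text \<open>The threshold is a quarter of the average multiplicity, so at most n^2/4 pairs have an
  unpopular product. Each element outside \<open>B\<close> is in at least n/2 of them, hence at most
  n/2 elements are lost.\<close>

lemma popular_products:
  fixes A :: "real set"
  assumes "finite A"
  obtains B \<Phi> where "B \<subseteq> A" "\<Phi> \<subseteq> A * A" "card A \<le> 2 * card B"
    "\<forall>p\<in>\<Phi>. (card A)\<^sup>2 \<le> 4 * card (A * A) * card (product_reps A p)"
    "\<forall>b\<in>B. card A \<le> 2 * card {c \<in> A. b * c \<in> \<Phi>}"
proof (cases "A = {}")
  case True
  then show ?thesis using that[of "{}" "{}"] by simp
next
  case False
  define n where "n = card A"
  define m where "m = card (A * A)"
  define \<Phi> where "\<Phi> = {p \<in> A * A. n\<^sup>2 \<le> 4 * m * card (product_reps A p)}"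
  define B where "B = {b \<in> A. n \<le> 2 * card {c \<in> A. b * c \<in> \<Phi>}}"
  define Q where "Q a = {c \<in> A. a * c \<notin> \<Phi>}" for a
  have fin: "finite (A * A)" using assms by (intro finite_set_times)
  have n: "n > 0" using False assms by (simp add: n_def card_gt_0_iff)
  have "A * A \<noteq> {}" using False by (auto simp: set_times_def)
  then have m: "m > 0" using fin by (simp add: m_def card_gt_0_iff)
  \<comment> \<open>The pairs with an unpopular product, fibred by that product.\<close>
  have "Sigma A Q = (\<Union>p\<in>A * A - \<Phi>. product_reps A p)"
    unfolding Q_def product_reps_def by (fastforce intro: set_times_intro)
  also have "card \<dots> = (\<Sum>p\<in>A * A - \<Phi>. card (product_reps A p))"
    using fin assms by (intro card_UN_disjoint) (auto, auto simp: product_reps_def)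
  finally have "4 * m * card (Sigma A Q) = (\<Sum>p\<in>A * A - \<Phi>. 4 * m * card (product_reps A p))"
    by (simp add: sum_distrib_left)
  also have "\<dots> \<le> card (A * A - \<Phi>) * n\<^sup>2"
    by (rule order_trans[OF sum_bounded_above[where K = "n\<^sup>2"]]) (auto simp: \<Phi>_def)
  also have "\<dots> \<le> m * n\<^sup>2" using fin by (simp add: m_def card_mono)
  finally have upper: "4 * card (Sigma A Q) \<le> n\<^sup>2" using m by simp
  have "n \<le> 2 * card (Q a)" if "a \<in> A - B" for a
  proof -
    have "A = {c \<in> A. a * c \<in> \<Phi>} \<union> Q a" by (auto simp: Q_def)
    then have "n \<le> card {c \<in> A. a * c \<in> \<Phi>} + card (Q a)" unfolding n_def by (metis card_Un_le)
    then show ?thesis using that by (auto simp: B_def)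
  qed
  then have "card (A - B) * n \<le> (\<Sum>a\<in>A - B. 2 * card (Q a))"
    using sum_bounded_below[of "A - B" n "\<lambda>a. 2 * card (Q a)"] by simp
  also have "\<dots> \<le> (\<Sum>a\<in>A. 2 * card (Q a))" using assms by (intro sum_mono2) auto
  also have "\<dots> = 2 * card (Sigma A Q)" using assms by (simp add: Q_def sum_distrib_left)
  finally have "2 * (card (A - B) * n) \<le> n * n" using upper unfolding power2_eq_square by linarith
  then have "(2 * card (A - B)) * n \<le> n * n" by (simp only: mult.assoc)
  then have "2 * card (A - B) \<le> n" using n by simp
  moreover have "B \<subseteq> A" by (auto simp: B_def)
  ultimately have "n \<le> 2 * card B"
    using assms card_Diff_subset[of B A] card_mono[of A B] finite_subset[of B A] by (simp add: n_def)
  show ?thesis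
  proof (rule that[of B \<Phi>])
    show "card A \<le> 2 * card B" using \<open>n \<le> 2 * card B\<close> by (simp add: n_def)
  qed (auto simp: B_def \<Phi>_def n_def m_def)
qed

section \<open>Three applications of the incidence bound\<close>

text \<open>For b in \<open>shift_part B x\<close> and c in \<open>A\<close>, the point (1/c, b - x)
  lies on the line of slope bc and intercept -x. This gives at least |X| t n incidences with m |X|
  lines.\<close>

lemma rich_differences_bound:
  fixes A :: "real set"
  assumes "finite A" "0 \<notin> A" "B \<subseteq> A" "X \<subseteq> differences B"
    and "\<And>x. x \<in> X \<Longrightarrow> t \<le> card (shift_part B x)"
  shows "card X * t ^ 3 \<le> 5832 * (card A * (card (A * A))\<^sup>2)"
proof (cases "X = {}")
  case False
  define n where "n = card A"
  define m where "m = card (A * A)"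
  define T where "T = (SIGMA x:X. shift_part B x \<times> A)"
  have cardI: "card (inverse ` A) = n" unfolding n_def by (intro card_image) (simp add: inj_on_def)
  have cardX: "card (uminus ` X) = card X" by (intro card_image) simp
  let ?I = "incidences (inverse ` A) A ((A * A) \<times> uminus ` X)"
  have finB: "finite B" using assms(1,3) by (rule rev_finite_subset)
  then have finX: "finite X" using assms(4) by (meson finite_differences finite_subset)
  have fin: "finite (A * A)" using assms by (intro finite_set_times)
  have "A \<noteq> {}" using False assms(3,4) by (auto simp: differences_def)
  then have n: "n > 0" using assms by (simp add: n_def card_gt_0_iff)
  have "card X * (t * n) \<le> (\<Sum>x\<in>X. card (shift_part B x \<times> A))"
    using sum_bounded_below[of X "t * n" "\<lambda>x. card (shift_part B x \<times> A)"] assms(5)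
    by (simp add: card_cartesian_product n_def)
  also have "\<dots> = card T" unfolding T_def using finX finB assms(1) by simp
  also have "card T \<le> card ?I"
  proof (rule card_inj_on_le[of "\<lambda>(x, b, c). ((b * c, - x), inverse c)"])
    show "inj_on (\<lambda>(x, b, c). ((b * c, - x), inverse c)) T"
      using assms(2) by (auto simp: inj_on_def T_def)
    show "(\<lambda>(x, b, c). ((b * c, - x), inverse c)) ` T \<subseteq> ?I"
    proof clarsimp
      fix x b c assume "(x, b, c) \<in> T"
      then have *: "x \<in> X" "b \<in> A" "b - x \<in> A" "c \<in> A" "c \<noteq> 0"
        using assms(2,3) by (auto simp: T_def shift_part_def)
      then show "((b * c, - x), inverse c) \<in> ?I"
        by (auto simp: incidences_def mult.assoc)
    qed
    show "finite ?I" using assms(1) finX fin by (intro finite_incidences) auto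
  qed
  finally have "(card X * (t * n)) ^ 3 \<le> card ?I ^ 3" by (rule power_mono) simp
  also have "\<dots> \<le> 5832 * (card (inverse ` A) * card A * card ((A * A) \<times> uminus ` X))\<^sup>2"
  proof (rule grid_incidence_bound)
    \<comment> \<open>There are not too many lines for the incidence bound: both |X| and m are at
      most n^2.\<close>
    have "card X \<le> card (differences B)" using finB assms(4) by (intro card_mono) auto
    also have "\<dots> \<le> (card B)\<^sup>2" by (rule card_differences_le[OF finB])
    also have "\<dots> \<le> n\<^sup>2"
      unfolding n_def using card_mono[OF assms(1,3)] by (intro power_mono) auto
    finally have "card X \<le> n\<^sup>2" .
    moreover have "m \<le> n\<^sup>2"
      using card_times_le[OF assms(1,1)] by (simp add: m_def n_def power2_eq_square)
    ultimately have "m * card X \<le> n\<^sup>2 * n\<^sup>2" by (intro mult_mono) auto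
    then show "card ((A * A) \<times> uminus ` X) \<le> (card (inverse ` A) * card A)\<^sup>2"
      unfolding card_cartesian_product cardI cardX power_mult_distrib
      by (simp only: m_def n_def power2_eq_square)
  qed (use assms(1) finX fin in \<open>auto simp: cardI n_def\<close>)
  also have "\<dots> = 5832 * (n * n * (m * card X))\<^sup>2"
    by (simp only: card_cartesian_product cardI cardX m_def n_def)
  finally have "(card X * (t * n)) ^ 3 \<le> 5832 * (n * n * (m * card X))\<^sup>2" .
  moreover have "(card X * (t * n)) ^ 3 = (card X * t ^ 3) * ((card X)\<^sup>2 * n ^ 3)" by algebra
  moreover have "5832 * (n * n * (m * card X))\<^sup>2 = (5832 * (n * m\<^sup>2)) * ((card X)\<^sup>2 * n ^ 3)"
    by algebra
  ultimately have "(card X * t ^ 3) * ((card X)\<^sup>2 * n ^ 3) \<le> (5832 * (n * m\<^sup>2)) * ((card X)\<^sup>2 * n ^ 3)"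
    by (simp only:)
  moreover have "(card X)\<^sup>2 * n ^ 3 > 0" using n False finX by (simp add: card_gt_0_iff)
  ultimately show ?thesis unfolding n_def m_def by (rule mult_right_le_imp_le)
qed auto

text \<open>If p = uv is popular and p - z is a product, then (v, p - z) lies on the line of slope u
  and intercept -z. Each z has at least t/4 such p, each p at least n^2/(4m) factorizations; 4096 is
  the cube of the resulting 16.\<close>

lemma rich_popular_differences_bound:
  fixes A :: "real set"
  assumes "finite A" "0 \<notin> A" "A \<noteq> {}" "\<Phi> \<subseteq> A * A" "finite Z" "card Z \<le> card A ^ 3"
    and pop: "\<And>p. p \<in> \<Phi> \<Longrightarrow> (card A)\<^sup>2 \<le> 4 * card (A * A) * card (product_reps A p)"
    and rich: "\<And>z. z \<in> Z \<Longrightarrow> t \<le> 4 * card {p \<in> \<Phi>. p - z \<in> A * A}"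
  shows "card Z * t ^ 3 * (card A)\<^sup>2 \<le> 4096 * 5832 * card (A * A) ^ 5"
proof (cases "Z = {}")
  case False
  define n where "n = card A"
  define m where "m = card (A * A)"
  have cardZ: "card (uminus ` Z) = card Z" by (intro card_image) simp
  define R where "R z = {p \<in> \<Phi>. p - z \<in> A * A}" for z
  define T where "T = (SIGMA z:Z. SIGMA p:R z. product_reps A p)"
  let ?I = "incidences A (A * A) (A \<times> uminus ` Z)"
  have fin: "finite (A * A)" using assms by (intro finite_set_times)
  then have fin\<Phi>: "finite \<Phi>" using assms(4) by (rule rev_finite_subset)
  then have finR: "finite (R z)" for z by (simp add: R_def)
  have n: "n > 0" using assms by (simp add: n_def card_gt_0_iff)
  have nm: "n \<le> m" using card_le_card_times_self assms by (simp add: n_def m_def)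
  have "t * n\<^sup>2 \<le> 16 * m * card (SIGMA p:R z. product_reps A p)" if "z \<in> Z" for z
  proof -
    have "t * n\<^sup>2 \<le> 4 * (card (R z) * n\<^sup>2)" using rich[OF that] by (simp add: R_def)
    also have "card (R z) * n\<^sup>2 \<le> (\<Sum>p\<in>R z. 4 * m * card (product_reps A p))"
      using sum_bounded_below[of "R z" "n\<^sup>2" "\<lambda>p. 4 * m * card (product_reps A p)"] pop
      by (simp add: R_def n_def m_def)
    also have "\<dots> = 4 * m * card (SIGMA p:R z. product_reps A p)"
      using finR assms(1) by (simp add: sum_distrib_left)
    finally show ?thesis by simp
  qed
  then have "card Z * (t * n\<^sup>2) \<le> (\<Sum>z\<in>Z. 16 * m * card (SIGMA p:R z. product_reps A p))"
    using sum_bounded_below[of Z "t * n\<^sup>2" "\<lambda>z. 16 * m * card (SIGMA p:R z. product_reps A p)"]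
    by simp
  also have "\<dots> = 16 * m * card T"
    unfolding T_def using finR assms(1,5) by (subst card_SigmaI) (auto simp: sum_distrib_left)
  also have "card T \<le> card ?I"
  proof (rule card_inj_on_le[of "\<lambda>(z, p, u, v). ((u, - z), v)"])
    show "inj_on (\<lambda>(z, p, u, v). ((u, - z), v)) T"
      by (auto simp: inj_on_def T_def product_reps_def)
    show "(\<lambda>(z, p, u, v). ((u, - z), v)) ` T \<subseteq> ?I"
      by (auto simp: T_def product_reps_def R_def incidences_def)
    show "finite ?I" using assms(1,5) by (intro finite_incidences) auto
  qed
  finally have "(card Z * (t * n\<^sup>2)) ^ 3 \<le> (16 * m * card ?I) ^ 3" by (intro power_mono) auto
  also have "\<dots> = 4096 * m ^ 3 * card ?I ^ 3" by (simp add: power_mult_distrib)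
  also have "card ?I ^ 3 \<le> 5832 * (card A * card (A * A) * card (A \<times> uminus ` Z))\<^sup>2"
  proof (rule grid_incidence_bound)
    have "n * card Z \<le> n * n ^ 3" using assms(6) by (simp add: n_def)
    also have "\<dots> = (n * n)\<^sup>2" by (simp add: power2_eq_square power3_eq_cube)
    also have "\<dots> \<le> (n * m)\<^sup>2" using nm by (intro power_mono) auto
    finally show "card (A \<times> uminus ` Z) \<le> (card A * card (A * A))\<^sup>2"
      by (simp only: card_cartesian_product cardZ m_def n_def)
  qed (use assms(1,5) fin nm in \<open>auto simp: n_def m_def\<close>)
  also have "card A * card (A * A) * card (A \<times> uminus ` Z) = n * m * (n * card Z)"
    by (simp only: card_cartesian_product cardZ m_def n_def)
  finally have "(card Z * (t * n\<^sup>2)) ^ 3 \<le> 4096 * m ^ 3 * (5832 * (n * m * (n * card Z))\<^sup>2)"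
    by simp
  moreover have "(card Z * (t * n\<^sup>2)) ^ 3 = (card Z * t ^ 3 * n\<^sup>2) * ((card Z)\<^sup>2 * n ^ 4)" by algebra
  moreover have "4096 * m ^ 3 * (5832 * (n * m * (n * card Z))\<^sup>2)
      = (4096 * 5832 * m ^ 5) * ((card Z)\<^sup>2 * n ^ 4)" by algebra
  ultimately have "(card Z * t ^ 3 * n\<^sup>2) * ((card Z)\<^sup>2 * n ^ 4)
      \<le> (4096 * 5832 * m ^ 5) * ((card Z)\<^sup>2 * n ^ 4)"
    by (simp only:)
  moreover have "(card Z)\<^sup>2 * n ^ 4 > 0" using n False assms(5) by (simp add: card_gt_0_iff)
  ultimately show ?thesis unfolding n_def m_def by (rule mult_right_le_imp_le)
qed auto

text \<open>Since y = (sc)/c + (y - s), the point (1/c, y) lies on the line of slope sc in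
  \<open>Z\<close> and intercept y - s in \<open>S\<close>. Every pair (s, y) has at least n/4
  choices of c, and 64 is 4^3.\<close>

lemma shift_pairs_upper_bound:
  fixes A :: "real set"
  assumes "finite A" "0 \<notin> A" "A \<noteq> {}" "finite S" "card A \<le> card S" "finite P"
    and C: "\<And>s. s \<in> P \<Longrightarrow> C s \<subseteq> A" "\<And>s. s \<in> P \<Longrightarrow> card A \<le> 4 * card (C s)"
    and Z: "finite Z" "card Z \<le> card A ^ 3" "\<And>s c. s \<in> P \<Longrightarrow> c \<in> C s \<Longrightarrow> s * c \<in> Z"
  shows "card (shift_pairs P S) ^ 3 * card A \<le> 64 * 5832 * (card S ^ 4 * (card Z)\<^sup>2)"
proof -
  define n where "n = card A"
  define N where "N = shift_pairs P S"
  have cardI: "card (inverse ` A) = n" unfolding n_def by (intro card_image) (simp add: inj_on_def)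
  define T where "T = (SIGMA q:N. C (fst q))"
  let ?I = "incidences (inverse ` A) S (Z \<times> S)"
  have n: "n > 0" using assms by (simp add: n_def card_gt_0_iff)
  have finN: "finite N" unfolding N_def shift_pairs_def using assms by auto
  have NP: "fst q \<in> P" if "q \<in> N" for q using that by (auto simp: N_def shift_pairs_def)
  have "card N * n \<le> (\<Sum>q\<in>N. 4 * card (C (fst q)))"
    using sum_bounded_below[of N n "\<lambda>q. 4 * card (C (fst q))"] C(2) NP by (simp add: n_def)
  also have "\<dots> = 4 * card T"
    unfolding T_def using finN C(1) NP finite_subset[OF _ assms(1)]
    by (subst card_SigmaI) (auto simp: sum_distrib_left)
  also have "card T \<le> card ?I"
  proof (rule card_inj_on_le[of "\<lambda>((s, y), c). ((s * c, y - s), inverse c)"])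
    have T: "s \<in> P" "c \<in> C s" "c \<in> A" "c \<noteq> 0" "y \<in> S" "y - s \<in> S" if "((s, y), c) \<in> T" for s y c
      using that C(1) assms(2) by (auto simp: T_def N_def shift_pairs_def shift_part_def)
    show "inj_on (\<lambda>((s, y), c). ((s * c, y - s), inverse c)) T"
      by (rule inj_onI) (use T(4) in force)
    show "(\<lambda>((s, y), c). ((s * c, y - s), inverse c)) ` T \<subseteq> ?I"
    proof clarsimp
      fix s y c assume "((s, y), c) \<in> T"
      note T = T[OF this]
      have "s * c * inverse c + (y - s) = y" using T(4) by simp
      then have "s * c * inverse c + (y - s) \<in> S" using T(5) by (simp only:)
      then show "((s * c, y - s), inverse c) \<in> ?I"
        unfolding incidences_def using T Z(3)[OF T(1,2)] by blast
    qed
    show "finite ?I" using assms(1,4) Z by (intro finite_incidences) auto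
  qed
  finally have "(card N * n) ^ 3 \<le> (4 * card ?I) ^ 3" by (intro power_mono) auto
  also have "\<dots> = 64 * card ?I ^ 3" by (simp add: power_mult_distrib)
  also have "card ?I ^ 3 \<le> 5832 * (card (inverse ` A) * card S * card (Z \<times> S))\<^sup>2"
  proof (rule grid_incidence_bound)
    have "card Z * card S \<le> n ^ 3 * card S" using Z(2) by (simp add: n_def)
    also have "\<dots> = n\<^sup>2 * (n * card S)" by (simp add: power2_eq_square power3_eq_cube)
    also have "\<dots> \<le> n\<^sup>2 * (card S * card S)" using assms(5) by (simp add: n_def)
    finally show "card (Z \<times> S) \<le> (card (inverse ` A) * card S)\<^sup>2"
      unfolding card_cartesian_product cardI power_mult_distrib by (simp only: power2_eq_square)
  qed (use assms(1,4,5) Z in \<open>auto simp: cardI n_def\<close>)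
  also have "card (inverse ` A) * card S * card (Z \<times> S) = n * card S * (card Z * card S)"
    by (simp only: card_cartesian_product cardI)
  finally have "(card N * n) ^ 3 \<le> 64 * (5832 * (n * card S * (card Z * card S))\<^sup>2)" by simp
  moreover have "(card N * n) ^ 3 = (card N ^ 3 * n) * n\<^sup>2" by algebra
  moreover have "64 * (5832 * (n * card S * (card Z * card S))\<^sup>2)
      = (64 * 5832 * (card S ^ 4 * (card Z)\<^sup>2)) * n\<^sup>2" by algebra
  ultimately have "(card N ^ 3 * n) * n\<^sup>2 \<le> (64 * 5832 * (card S ^ 4 * (card Z)\<^sup>2)) * n\<^sup>2"
    by (simp only:)
  then show ?thesis unfolding n_def N_def using n by (simp add: n_def)
qed

section \<open>Elimination of the auxiliary parameters\<close>

text \<open>Here \<open>p\<close>, \<open>\<sigma>\<close>, \<open>z\<close> stand for |P|, |S|,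
  |Z|, and \<open>K\<close> for the incidence constant. Cubing \<open>lower\<close> lets
  \<open>upper\<close> remove \<open>N\<close>, and squaring \<open>Z\<close> removes
  \<open>z\<close>.\<close>

lemma combine_bounds:
  fixes n b p \<tau> \<sigma> N z L m K :: nat
  assumes "n > 0" "n \<le> 2 * b"
    and energy: "b ^ 4 \<le> \<sigma> * (4 * L * (p * \<tau>\<^sup>2))"
    and lower: "(b * (p * \<tau>))\<^sup>2 \<le> N * (8 * L * (K * (n * m\<^sup>2)))"
    and Z: "z * \<tau> ^ 3 * n\<^sup>2 \<le> 4096 * K * m ^ 5"
    and upper: "N ^ 3 * n \<le> 64 * K * (\<sigma> ^ 4 * z\<^sup>2)"
  shows "n ^ 32 \<le> 64 ^ 6 * (32 * K) ^ 3 * (64 * K) * (4096 * K)\<^sup>2 * (L ^ 9 * m ^ 16 * \<sigma> ^ 10)"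
proof -
  have "n ^ 4 \<le> (2 * b) ^ 4" using assms(2) by (intro power_mono) auto
  also have "\<dots> = 16 * b ^ 4" by (simp add: power_mult_distrib)
  also have "\<dots> \<le> 16 * (\<sigma> * (4 * L * (p * \<tau>\<^sup>2)))" using energy by (rule mult_le_mono2)
  also have "\<dots> = 64 * L * \<sigma> * (p * \<tau>\<^sup>2)" by algebra
  finally have a: "n ^ 4 \<le> 64 * L * \<sigma> * (p * \<tau>\<^sup>2)" .
  have "(n * (p * \<tau>)\<^sup>2) * n = (n * (p * \<tau>))\<^sup>2" by algebra
  also have "\<dots> \<le> (2 * b * (p * \<tau>))\<^sup>2" using assms(2) by (intro power_mono mult_mono) auto
  also have "\<dots> = 4 * (b * (p * \<tau>))\<^sup>2" by algebra
  also have "\<dots> \<le> 4 * (N * (8 * L * (K * (n * m\<^sup>2))))" using lower by (rule mult_le_mono2)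
  also have "\<dots> = (32 * K * L * m\<^sup>2 * N) * n" by algebra
  finally have b: "n * (p * \<tau>)\<^sup>2 \<le> 32 * K * L * m\<^sup>2 * N" using assms(1) by simp
  \<comment> \<open>The factor \<open>\<tau> ^ 6 * n ^ 4\<close> is what the square of
    \<open>Z\<close> absorbs; it completes (p \<tau>)^6 to a power of p \<tau>^2, the quantity that
    \<open>energy\<close> controls.\<close>
  have "n ^ 8 * (p * \<tau>\<^sup>2) ^ 6 = (n * (p * \<tau>)\<^sup>2) ^ 3 * (n * (\<tau> ^ 6 * n ^ 4))" by algebra
  also have "\<dots> \<le> (32 * K * L * m\<^sup>2 * N) ^ 3 * (n * (\<tau> ^ 6 * n ^ 4))"
    using b by (intro mult_right_mono power_mono) auto
  also have "\<dots> = ((32 * K) ^ 3 * L ^ 3 * m ^ 6 * \<tau> ^ 6 * n ^ 4) * (N ^ 3 * n)" by algebra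
  also have "\<dots> \<le> ((32 * K) ^ 3 * L ^ 3 * m ^ 6 * \<tau> ^ 6 * n ^ 4) * (64 * K * (\<sigma> ^ 4 * z\<^sup>2))"
    using upper by (intro mult_left_mono) auto
  also have "\<dots> = ((32 * K) ^ 3 * (64 * K) * L ^ 3 * m ^ 6 * \<sigma> ^ 4) * (z * \<tau> ^ 3 * n\<^sup>2)\<^sup>2" by algebra
  also have "\<dots> \<le> ((32 * K) ^ 3 * (64 * K) * L ^ 3 * m ^ 6 * \<sigma> ^ 4) * (4096 * K * m ^ 5)\<^sup>2"
    using Z by (intro mult_left_mono power_mono) auto
  finally have c: "n ^ 8 * (p * \<tau>\<^sup>2) ^ 6
      \<le> ((32 * K) ^ 3 * (64 * K) * L ^ 3 * m ^ 6 * \<sigma> ^ 4) * (4096 * K * m ^ 5)\<^sup>2" .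
  have "n ^ 32 = n ^ 8 * (n ^ 4) ^ 6" by algebra
  also have "\<dots> \<le> n ^ 8 * (64 * L * \<sigma> * (p * \<tau>\<^sup>2)) ^ 6"
    using a by (intro mult_left_mono power_mono) auto
  also have "\<dots> = (64 * L * \<sigma>) ^ 6 * (n ^ 8 * (p * \<tau>\<^sup>2) ^ 6)" by algebra
  also have "\<dots> \<le> (64 * L * \<sigma>) ^ 6 *
      (((32 * K) ^ 3 * (64 * K) * L ^ 3 * m ^ 6 * \<sigma> ^ 4) * (4096 * K * m ^ 5)\<^sup>2)"
    using c by (intro mult_left_mono) auto
  also have "\<dots> = 64 ^ 6 * (32 * K) ^ 3 * (64 * K) * (4096 * K)\<^sup>2 * (L ^ 9 * m ^ 16 * \<sigma> ^ 10)"
    by algebra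
  finally show ?thesis .
qed

text \<open>\<open>L\<close> bounds the number of dyadic levels of |B_s|. The level \<open>P\<close>
  is chosen for the second moment, while the third moment is taken over all differences of
  \<open>B\<close>.\<close>

lemma sum_product_bound:
  fixes A :: "real set"
  assumes "finite A" "0 \<notin> A" "A \<noteq> {}" "card A < 2 ^ L"
  shows "card A ^ 32 \<le> 64 ^ 6 * (32 * 5832) ^ 3 * (64 * 5832) * (4096 * 5832)\<^sup>2
    * (L ^ 9 * card (A * A) ^ 16 * card (A + A) ^ 10)"
proof -
  obtain B \<Phi> where BA: "B \<subseteq> A" and \<Phi>: "\<Phi> \<subseteq> A * A" and AB: "card A \<le> 2 * card B"
    and pop: "\<forall>p\<in>\<Phi>. (card A)\<^sup>2 \<le> 4 * card (A * A) * card (product_reps A p)"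
    and cols: "\<forall>b\<in>B. card A \<le> 2 * card {c \<in> A. b * c \<in> \<Phi>}"
    by (rule popular_products[OF assms(1)])
  define r where "r s = card (shift_part B s)" for s
  define D where "D = differences B"
  have n: "card A > 0" using assms by (simp add: card_gt_0_iff)
  have finB: "finite B" using assms(1) BA by (rule rev_finite_subset)
  have finS: "finite (A + A)" using assms(1) by (intro finite_set_plus)
  have fin\<Phi>: "finite \<Phi>" using \<Phi> assms(1) by (meson finite_set_times finite_subset)
  have cardB: "card B \<le> card A" using assms(1) BA by (rule card_mono)
  have finD: "finite D" by (simp add: D_def finB)
  have r1: "1 \<le> r s" if "s \<in> D" for s
    using card_shift_part_bounds(1)[OF finB] that by (simp add: r_def D_def)
  have r2: "r s < 2 ^ L" if "s \<in> D" for s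
    using card_shift_part_bounds(2)[OF finB, of s] that cardB assms(4) by (simp add: r_def D_def)
  have L: "L > 0" using assms(4) n by (cases L) auto
  obtain k where k: "(\<Sum>s\<in>D. (r s)\<^sup>2) \<le> 4 * L * (card (dyadic_level r D k) * (2 ^ k)\<^sup>2)"
    using dyadic_pigeonhole[where r = r, OF finD r1 r2 L] by blast
  define P where "P = dyadic_level r D k"
  define \<tau> where "\<tau> = (2::nat) ^ k"
  have PD: "P \<subseteq> D" and rP: "\<And>s. s \<in> P \<Longrightarrow> \<tau> \<le> r s"
    by (auto simp: P_def dyadic_level_def \<tau>_def)
  have finP: "finite P" using finD PD by (rule rev_finite_subset)
  \<comment> \<open>The multipliers c for which at least a quarter of the b in
    \<open>shift_part B s\<close> have bc popular.\<close>
  define C where "C s = {c \<in> A. r s \<le> 4 * card {b \<in> shift_part B s. b * c \<in> \<Phi>}}" for s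
  \<comment> \<open>The first set yields |Z| \<le> |P| |A| \<le> n^3, the second yields richness;
    what remains to check is that \<open>Z\<close> contains s c for c in \<open>C s\<close>.\<close>
  define Z where "Z = (\<lambda>(s, c). s * c) ` (P \<times> A) \<inter> {z. \<tau> \<le> 4 * card {p \<in> \<Phi>. p - z \<in> A * A}}"
  have finZ: "finite Z" using finP assms(1) by (simp add: Z_def)
  have "card P \<le> (card A)\<^sup>2"
    using card_mono[OF finD PD] card_differences_le[OF finB] power_mono[OF cardB, of 2]
    unfolding D_def by linarith
  then have "card (P \<times> A) \<le> (card A)\<^sup>2 * card A"
    unfolding card_cartesian_product by (rule mult_le_mono1)
  moreover have "card Z \<le> card (P \<times> A)"
    unfolding Z_def using finP assms(1)
    by (intro order_trans[OF card_mono card_image_le]) auto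
  ultimately have cardZ: "card Z \<le> card A ^ 3"
    by (simp add: power3_eq_cube power2_eq_square)
  have CZ: "s * c \<in> Z" if s: "s \<in> P" and c: "c \<in> C s" for s c
  proof -
    have "c \<in> A" "c \<noteq> 0" using c assms(2) by (auto simp: C_def)
    have "\<tau> \<le> 4 * card {b \<in> shift_part B s. b * c \<in> \<Phi>}"
      using rP[OF s] c by (simp add: C_def)
    \<comment> \<open>Because bc - sc = (b - s)c is again a product of elements of
      \<open>A\<close>.\<close>
    also have "card {b \<in> shift_part B s. b * c \<in> \<Phi>} \<le> card {p \<in> \<Phi>. p - s * c \<in> A * A}"
    proof (rule card_inj_on_le[of "\<lambda>b. b * c"])
      show "inj_on (\<lambda>b. b * c) {b \<in> shift_part B s. b * c \<in> \<Phi>}"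
        using \<open>c \<noteq> 0\<close> by (auto simp: inj_on_def)
      have "b * c - s * c \<in> A * A" if "b \<in> shift_part B s" for b
        using that BA \<open>c \<in> A\<close> by (auto simp: shift_part_def simp flip: left_diff_distrib)
      then show "(\<lambda>b. b * c) ` {b \<in> shift_part B s. b * c \<in> \<Phi>} \<subseteq> {p \<in> \<Phi>. p - s * c \<in> A * A}"
        by auto
    qed (simp add: fin\<Phi>)
    finally show ?thesis using s \<open>c \<in> A\<close> by (auto simp: Z_def)
  qed
  have Ccard: "card A \<le> 4 * card (C s)" if "s \<in> P" for s
  proof -
    have "shift_part B s \<noteq> {}" using r1[of s] PD that by (auto simp: r_def)
    then show ?thesis
      unfolding C_def r_def using finB assms(1) cols
      by (intro popular_columns) (auto simp: shift_part_def)
  qed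
  have "card P * \<tau> \<le> (\<Sum>s\<in>P. r s)" using sum_bounded_below[of P \<tau> r] rP by simp
  then have "(card B * (card P * \<tau>))\<^sup>2 \<le> (card B * (\<Sum>s\<in>P. r s))\<^sup>2"
    by (intro power_mono mult_left_mono) auto
  also have "\<dots> \<le> card (shift_pairs P (B + B)) * (\<Sum>x\<in>D. r x ^ 3)"
    unfolding r_def D_def by (rule shift_pairs_lower_bound[OF finB finP])
  also have "\<dots> \<le> card (shift_pairs P (A + A)) * (8 * L * (5832 * (card A * (card (A * A))\<^sup>2)))"
  proof (rule mult_mono)
    have "B + B \<subseteq> A + A" using BA by (intro set_plus_mono2)
    then show "card (shift_pairs P (B + B)) \<le> card (shift_pairs P (A + A))"
      using finP finS by (intro card_mono) (auto simp: shift_pairs_def shift_part_def)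
    show "(\<Sum>x\<in>D. r x ^ 3) \<le> 8 * L * (5832 * (card A * (card (A * A))\<^sup>2))"
    proof (rule sum_cubes_dyadic_le[OF finD r1 r2])
      fix k show "card (dyadic_level r D k) * (2 ^ k) ^ 3 \<le> 5832 * (card A * (card (A * A))\<^sup>2)"
        by (rule rich_differences_bound[OF assms(1,2) BA])
          (auto simp: dyadic_level_def D_def r_def)
    qed
  qed auto
  finally have lower: "(card B * (card P * \<tau>))\<^sup>2
    \<le> card (shift_pairs P (A + A)) * (8 * L * (5832 * (card A * (card (A * A))\<^sup>2)))" .
  have "card B ^ 4 \<le> card (B + B) * (\<Sum>s\<in>D. (r s)\<^sup>2)"
    unfolding r_def D_def by (rule card_pow4_le_energy[OF finB])
  also have "\<dots> \<le> card (A + A) * (4 * L * (card P * \<tau>\<^sup>2))"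
    using k finS BA unfolding P_def \<tau>_def by (intro mult_mono card_mono set_plus_mono2) auto
  finally have energy: "card B ^ 4 \<le> card (A + A) * (4 * L * (card P * \<tau>\<^sup>2))" .
  have Zb: "card Z * \<tau> ^ 3 * (card A)\<^sup>2 \<le> 4096 * 5832 * card (A * A) ^ 5"
    by (rule rich_popular_differences_bound[OF assms(1-3) \<Phi> finZ cardZ bspec[OF pop]]) (auto simp: Z_def)
  have upper: "card (shift_pairs P (A + A)) ^ 3 * card A
      \<le> 64 * 5832 * (card (A + A) ^ 4 * (card Z)\<^sup>2)"
    by (rule shift_pairs_upper_bound[OF assms(1-3) finS card_le_card_plus_self[OF assms(1)] finP
        _ Ccard finZ cardZ CZ]) (auto simp: C_def)
  show ?thesis by (rule combine_bounds[OF n AB energy lower Zb upper])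
qed

theorem theorem24:
  shows "\<exists>c C :: real. c > 0 \<and> C \<ge> 0 \<and>
    (\<forall>A :: real set. finite A \<longrightarrow> card A > 1 \<longrightarrow> 0 \<notin> A \<longrightarrow>
      real (card (A + A)) ^ 10 * real (card (A * A)) ^ 17
        \<ge> c * (real (card A) ^ 33 / (log 2 (real (card A)) powr C)))"
proof -
  define K :: nat where "K = 64 ^ 6 * (32 * 5832) ^ 3 * (64 * 5832) * (4096 * 5832)\<^sup>2"
  have K: "K > 0" by (simp add: K_def)
  have "real (card (A + A)) ^ 10 * real (card (A * A)) ^ 17
      \<ge> 1 / (K * 2 ^ 9) * (real (card A) ^ 33 / (log 2 (real (card A)) powr 9))"
    if A: "finite A" "card A > 1" "0 \<notin> A" for A :: "real set"
  proof -
    define n where "n = card A"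
    define l where "l = log 2 (real n)"
    \<comment> \<open>The least exponent with n < 2^L. As n \<ge> 2 gives l \<ge> 1, it is at most 2
      l, whence the factor 2^9 in the constant.\<close>
    define L where "L = nat \<lfloor>l\<rfloor> + 1"
    have l: "l \<ge> 1" using A(2) by (simp add: l_def n_def le_log_iff)
    have "real n = 2 powr l" using A(2) by (simp add: l_def n_def)
    also have "\<dots> < 2 powr real L" unfolding L_def using l by (intro powr_less_mono) linarith+
    also have "\<dots> = real (2 ^ L)" by (simp add: powr_realpow)
    finally have nL: "n < 2 ^ L" using of_nat_less_iff by blast
    have L: "real L \<le> 2 * l" unfolding L_def using l by linarith
    have "A \<noteq> {}" using A(2) by auto
    then have "n ^ 32 \<le> K * (L ^ 9 * card (A * A) ^ 16 * card (A + A) ^ 10)"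
      using sum_product_bound[OF A(1,3) _ nL[unfolded n_def]] by (simp only: K_def n_def not_False_eq_True)
    \<comment> \<open>This extra factor turns the exponents 32 and 16 into 33 and 17.\<close>
    moreover have "n \<le> card (A * A)" unfolding n_def by (rule card_le_card_times_self[OF A(1,3)])
    moreover have "n ^ 33 = n ^ 32 * n" by (simp flip: power_Suc2)
    ultimately have "n ^ 33 \<le> K * (L ^ 9 * card (A * A) ^ 16 * card (A + A) ^ 10) * card (A * A)"
      by (simp only: mult_mono zero_le)
    also have "\<dots> = K * L ^ 9 * (card (A + A) ^ 10 * card (A * A) ^ 17)" by algebra
    finally have "real (n ^ 33) \<le> real (K * L ^ 9 * (card (A + A) ^ 10 * card (A * A) ^ 17))"
      by (simp only: of_nat_le_iff)
    also have "\<dots> = K * real L ^ 9 * (real (card (A + A)) ^ 10 * real (card (A * A)) ^ 17)"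
      by simp
    also have "\<dots> \<le> K * (2 * l) ^ 9 * (real (card (A + A)) ^ 10 * real (card (A * A)) ^ 17)"
      using L by (intro mult_right_mono mult_left_mono power_mono) auto
    finally have "real n ^ 33 \<le> (K * 2 ^ 9) * l ^ 9 * (real (card (A + A)) ^ 10 * real (card (A * A)) ^ 17)"
      by (simp add: power_mult_distrib)
    moreover have "l powr 9 = l ^ 9" using l by simp
    ultimately show ?thesis
      using K l unfolding l_def[symmetric] n_def[symmetric] by (simp add: field_simps)
  qed
  then show ?thesis using K by (intro exI[of _ "1 / (real K * 2 ^ 9)"] exI[of _ 9]) auto
qed

end
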